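(* Let $\mathcal{H}$ be a separable Hilbert space, $I$ a countable index set, and $\varphi=\{\varphi_i\}_{i\in I}$ a frame for $\mathcal{H}$. Then the following assertions hold. (i) If $\psi=\{\psi_i\}_{i\in I}$ is a dual frame of $\varphi$ such that for every $J\subseteq I$ the family $\{\varphi_i\}_{i\in J}\cup\{\psi_i\}_{i\in J^c}$ is a frame sequence, then $\varphi$ and $\psi$ are woven. (ii) If $\varphi$ is a Riesz basis for $\mathcal{H}$, then $\varphi$ and its canonical dual $\{S_\varphi^{-1}\varphi_i\}_{i\in I}$ are woven.
   Context: A family $\{\varphi_i\}_{i\in I}$ in $\mathcal{H}$ is a frame for $\mathcal{H}$ with bounds $0<A\le B<\infty$ if $A\Vert f\Vert^2\le\sum_{i\in I}|\langle f,\varphi_i\rangle|^2\le B\Vert f\Vert^2$ for all $f\in\mathcal{H}$. A frame sequence is a family that is a frame for its closed linear span. The frame operator is $S_\varphi f=\sum_{i\in I}\langle f,\varphi_i\rangle\varphi_i$, which is bounded, invertible and self-adjoint; the canonical dual of $\varphi$ is $\{S_\varphi^{-1}\varphi_i\}_{i\in I}$. A frame $\{\psi_i\}_{i\in I}$ is a dual frame of $\varphi$ if $f=\sum_{i\in I}\langle f,\psi_i\rangle\varphi_i$ for all $f\in\mathcal{H}$. Two frames $\{\varphi_i\}_{i\in I}$ and $\{\psi_i\}_{i\in I}$ are woven if there are constants $0<A\le B<\infty$ such that for every $J\subseteq I$ the family $\{\varphi_i\}_{i\in J}\cup\{\psi_i\}_{i\in J^c}$ (with $J^c=I\setminus J$,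 counted with indices) is a frame for $\mathcal{H}$ with bounds $A$ and $B$. *)

theory Defs
  imports "HOL-Analysis.Analysis"
begin

text \<open>
  Hilbert spaces are taken over a scalar field that is either the reals or the complex numbers.
  The class below has exactly these two models up to isomorphism (Gelfand-Mazur: the norm of a
  \<^class>\<open>real_normed_field\<close> is multiplicative); the last axiom determines the operation
  \<open>scnj\<close>: it is complex conjugation on the complex numbers and the identity on the reals.
\<close>

class real_or_complex = real_normed_field + complete_space +
  fixes scnj :: "'a \<Rightarrow> 'a"
  assumes scnj_add: "scnj (x + y) = scnj x + scnj y"
    and scnj_mult: "scnj (x * y) = scnj x * scnj y"
    and scnj_scnj: "scnj (scnj x) = x"
    and mult_scnj: "x * scnj x = (norm x)\<^sup>2 *\<^sub>R 1"

instantiation real :: real_or_complex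
begin

definition scnj_real :: "real \<Rightarrow> real" where "scnj_real x = x"

instance
  by standard (simp_all add: scnj_real_def power2_eq_square)

end

instantiation complex :: real_or_complex
begin

definition scnj_complex :: "complex \<Rightarrow> complex" where "scnj_complex = cnj"

instance
  by standard (simp_all add: scnj_complex_def complex_norm_square[symmetric] scaleR_conv_of_real)

end

text \<open>
  The norm, and with it topology and completeness, comes from the class \<^class>\<open>banach\<close>
  of the vectors; the locale ties it to the inner product, which is linear in its first argument.
\<close>

locale hilbert_space = vector_space smul
  for smul :: "'k::real_or_complex \<Rightarrow> 'a::banach \<Rightarrow> 'a" +
  fixes ip :: "'a \<Rightarrow> 'a \<Rightarrow> 'k"
  assumes scale_of_real: "smul (of_real r) x = r *\<^sub>R x"
    and ip_add_left: "ip (x + y) z = ip x z + ip y z"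
    and ip_scale_left: "ip (smul c x) y = c * ip x y"
    and ip_commute: "ip y x = scnj (ip x y)"
    and ip_self: "ip x x = of_real ((norm x)\<^sup>2)"

lemma hilbert_space_real:
  "hilbert_space (scaleR :: real \<Rightarrow> 'a \<Rightarrow> 'a) (inner :: 'a::{real_inner,banach} \<Rightarrow> 'a \<Rightarrow> real)"
  by unfold_locales
     (simp_all add: scaleR_add_right scaleR_add_left inner_add_left inner_add_right inner_commute scnj_real_def
        dot_square_norm)

lemma hilbert_space_complex:
  "hilbert_space ((*) :: complex \<Rightarrow> complex \<Rightarrow> complex) (\<lambda>x y. x * cnj y)"
  by unfold_locales
     (simp_all add: algebra_simps scaleR_conv_of_real scnj_complex_def complex_norm_square[symmetric])

definition separable :: "'a::topological_space set \<Rightarrow> bool" where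
  "separable X \<longleftrightarrow> (\<exists>D. countable D \<and> D \<subseteq> X \<and> X \<subseteq> closure D)"

text \<open>
  In the following, \<open>V\<close> is the closed subspace for which the family is a frame. Since
  \<^const>\<open>infsum\<close> is 0 for a divergent series, convergence is stated separately.
\<close>

definition frame_with_bounds ::
  "('a::banach \<Rightarrow> 'a \<Rightarrow> 'k::real_or_complex) \<Rightarrow> 'a set \<Rightarrow> 'i set \<Rightarrow> ('i \<Rightarrow> 'a) \<Rightarrow> real \<Rightarrow> real \<Rightarrow> bool"
  where "frame_with_bounds ip V I \<phi> A B \<longleftrightarrow>
    0 < A \<and> A \<le> B \<and> \<phi> ` I \<subseteq> V \<and>
    (\<forall>f\<in>V. (\<lambda>i. (norm (ip f (\<phi> i)))\<^sup>2) summable_on I \<and>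
       A * (norm f)\<^sup>2 \<le> (\<Sum>\<^sub>\<infinity>i\<in>I. (norm (ip f (\<phi> i)))\<^sup>2) \<and>
       (\<Sum>\<^sub>\<infinity>i\<in>I. (norm (ip f (\<phi> i)))\<^sup>2) \<le> B * (norm f)\<^sup>2)"

definition is_frame ::
  "('a::banach \<Rightarrow> 'a \<Rightarrow> 'k::real_or_complex) \<Rightarrow> 'a set \<Rightarrow> 'i set \<Rightarrow> ('i \<Rightarrow> 'a) \<Rightarrow> bool"
  where "is_frame ip V I \<phi> \<longleftrightarrow> (\<exists>A B. frame_with_bounds ip V I \<phi> A B)"

definition closed_span ::
  "('k::real_or_complex \<Rightarrow> 'a::banach \<Rightarrow> 'a) \<Rightarrow> 'a set \<Rightarrow> 'a set"
  where "closed_span smul X = closure (module.span smul X)"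

definition frame_sequence ::
  "('k::real_or_complex \<Rightarrow> 'a::banach \<Rightarrow> 'a) \<Rightarrow> ('a \<Rightarrow> 'a \<Rightarrow> 'k) \<Rightarrow> 'i set \<Rightarrow> ('i \<Rightarrow> 'a) \<Rightarrow> bool"
  where "frame_sequence smul ip I \<phi> \<longleftrightarrow> is_frame ip (closed_span smul (\<phi> ` I)) I \<phi>"

definition frame_operator ::
  "('k::real_or_complex \<Rightarrow> 'a::banach \<Rightarrow> 'a) \<Rightarrow> ('a \<Rightarrow> 'a \<Rightarrow> 'k) \<Rightarrow> 'i set \<Rightarrow> ('i \<Rightarrow> 'a) \<Rightarrow> 'a \<Rightarrow> 'a"
  where "frame_operator smul ip I \<phi> f = (\<Sum>\<^sub>\<infinity>i\<in>I. smul (ip f (\<phi> i)) (\<phi> i))"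

definition canonical_dual ::
  "('k::real_or_complex \<Rightarrow> 'a::banach \<Rightarrow> 'a) \<Rightarrow> ('a \<Rightarrow> 'a \<Rightarrow> 'k) \<Rightarrow> 'i set \<Rightarrow> ('i \<Rightarrow> 'a) \<Rightarrow> 'i \<Rightarrow> 'a"
  where "canonical_dual smul ip I \<phi> i = inv (frame_operator smul ip I \<phi>) (\<phi> i)"

text \<open>\<open>dual_frame smul ip I \<phi> \<psi>\<close>: the family \<open>\<psi>\<close> is a dual frame of \<open>\<phi>\<close>.\<close>

definition dual_frame ::
  "('k::real_or_complex \<Rightarrow> 'a::banach \<Rightarrow> 'a) \<Rightarrow> ('a \<Rightarrow> 'a \<Rightarrow> 'k) \<Rightarrow> 'i set \<Rightarrow>
     ('i \<Rightarrow> 'a) \<Rightarrow> ('i \<Rightarrow> 'a) \<Rightarrow> bool"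
  where "dual_frame smul ip I \<phi> \<psi> \<longleftrightarrow>
    is_frame ip UNIV I \<psi> \<and>
    (\<forall>f. ((\<lambda>i. smul (ip f (\<psi> i)) (\<phi> i)) has_sum f) I)"

text \<open>
  The union of the subfamilies over \<open>J\<close> and its complement is again a family indexed by the
  whole index set, so repeated vectors are counted with their indices.
\<close>

definition weaving :: "'i set \<Rightarrow> ('i \<Rightarrow> 'a) \<Rightarrow> ('i \<Rightarrow> 'a) \<Rightarrow> 'i \<Rightarrow> 'a" where
  "weaving J \<phi> \<psi> i = (if i \<in> J then \<phi> i else \<psi> i)"

definition woven ::
  "('a::banach \<Rightarrow> 'a \<Rightarrow> 'k::real_or_complex) \<Rightarrow> 'i set \<Rightarrow> ('i \<Rightarrow> 'a) \<Rightarrow> ('i \<Rightarrow> 'a) \<Rightarrow> bool"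
  where "woven ip I \<phi> \<psi> \<longleftrightarrow>
    is_frame ip UNIV I \<phi> \<and> is_frame ip UNIV I \<psi> \<and>
    (\<exists>A B. 0 < A \<and> A \<le> B \<and>
       (\<forall>J. J \<subseteq> I \<longrightarrow> frame_with_bounds ip UNIV I (weaving J \<phi> \<psi>) A B))"

text \<open>A complete family satisfying the two-sided Riesz inequality for all finite scalar families.\<close>

definition riesz_basis ::
  "('k::real_or_complex \<Rightarrow> 'a::banach \<Rightarrow> 'a) \<Rightarrow> 'i set \<Rightarrow> ('i \<Rightarrow> 'a) \<Rightarrow> bool"
  where "riesz_basis smul I \<phi> \<longleftrightarrow>
    closed_span smul (\<phi> ` I) = UNIV \<and>
    (\<exists>A B. 0 < A \<and> A \<le> B \<and>
       (\<forall>F c. finite F \<and> F \<subseteq> I \<longrightarrow>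
          A * (\<Sum>i\<in>F. (norm (c i))\<^sup>2) \<le> (norm (\<Sum>i\<in>F. smul (c i) (\<phi> i)))\<^sup>2 \<and>
          (norm (\<Sum>i\<in>F. smul (c i) (\<phi> i)))\<^sup>2 \<le> B * (\<Sum>i\<in>F. (norm (c i))\<^sup>2)))"

end

theory Submission
  imports Defs
begin

text \<open>
  If \<open>\<psi>\<close> is a dual frame of \<open>\<phi>\<close>, then \<open>\<parallel>f\<parallel>\<^sup>2 = (\<Sum>i. \<langle>f, \<psi>\<^sub>i\<rangle> \<langle>\<phi>\<^sub>i, f\<rangle>)\<close>. In each term one factor
  belongs to the weaving of \<open>J\<close> and the other to the weaving of the complement of \<open>J\<close>, whose
  coefficients have square sum at most \<open>C \<parallel>f\<parallel>\<^sup>2\<close>, where \<open>C\<close> is the sum of the two upper frame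
  bounds. By Cauchy-Schwarz, \<open>1 / C\<close> is a lower frame bound for every weaving. So a frame is woven with each
  of its dual frames, in particular with the canonical one. That the latter is a dual
  frame rests on the invertibility of \<open>S\<close>: for \<open>t = A / B\<^sup>2\<close> the map \<open>g \<mapsto> g - t (S g - h)\<close> is a
  contraction, and its fixed point solves \<open>S g = h\<close>.
\<close>

section \<open>Two elementary estimates\<close>

lemma mult_le_half_weighted_squares:
  fixes a b s :: real
  assumes "s > 0"
  shows "a * b \<le> (s * a\<^sup>2 + b\<^sup>2 / s) / 2"
proof -
  have "0 \<le> (s * a - b)\<^sup>2 / s"
    using assms by simp
  also have "\<dots> = s * a\<^sup>2 - 2 * (a * b) + b\<^sup>2 / s"
    using assms by (simp add: power2_eq_square field_simps)
  finally show ?thesis by simp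
qed

lemma norm_has_sum_le_finite_sums:
  fixes g :: "'i \<Rightarrow> 'a::real_normed_vector"
  assumes "(g has_sum s) I" "\<And>F. finite F \<Longrightarrow> F \<subseteq> I \<Longrightarrow> norm (sum g F) \<le> b"
  shows "norm s \<le> b"
proof (rule Lim_norm_ubound)
  show "(sum g \<longlongrightarrow> s) (finite_subsets_at_top I)"
    using assms(1) by (simp add: has_sum_def)
qed (use assms(2) in \<open>auto intro!: eventually_finite_subsets_at_top_weakI\<close>)

section \<open>Conjugation of scalars\<close>

lemma scnj_zero [simp]: "scnj 0 = (0 :: 'k::real_or_complex)"
  using scnj_add[of "0 :: 'k" 0] by simp

text \<open>Taking norms in \<open>mult_scnj\<close> and cancelling \<open>norm x\<close> gives the
  claim for nonzero \<open>x\<close>.\<close>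

lemma norm_scnj [simp]: "norm (scnj (x :: 'k::real_or_complex)) = norm x"
proof (cases "x = 0")
  case False
  have "norm x * norm (scnj x) = norm x * norm x"
    using mult_scnj[of x] by (simp add: norm_mult[symmetric] power2_eq_square)
  with False show ?thesis by simp
qed simp

lemma scnj_of_real [simp]: "scnj (of_real r) = (of_real r :: 'k::real_or_complex)"
proof (cases "r = 0")
  case False
  have "(of_real r :: 'k) * scnj (of_real r) = of_real r * of_real r"
    using mult_scnj[of "of_real r :: 'k"] by (simp add: scaleR_conv_of_real power2_eq_square)
  with False show ?thesis by simp
qed simp

lemma mult_scnj_of_real: "x * scnj x = (of_real ((norm x)\<^sup>2) :: 'k::real_or_complex)"
  using mult_scnj[of x] by (simp add: scaleR_conv_of_real)

context hilbert_space
begin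

section \<open>Sesquilinearity and the Cauchy-Schwarz inequality\<close>

lemma ip_add_right: "ip x (y + z) = ip x y + ip x z"
  by (metis ip_add_left ip_commute scnj_add)

lemma ip_scale_right: "ip x (smul c y) = scnj c * ip x y"
  by (metis ip_scale_left ip_commute scnj_mult)

lemma ip_scaleR_left: "ip (r *\<^sub>R x) y = r *\<^sub>R ip x y"
  by (metis ip_scale_left scale_of_real scaleR_conv_of_real)

lemma ip_scaleR_right: "ip x (r *\<^sub>R y) = r *\<^sub>R ip x y"
  by (metis ip_scale_right scale_of_real scaleR_conv_of_real scnj_of_real)

lemma ip_diff_left: "ip (x - y) z = ip x z - ip y z"
  by (metis ip_add_left add_diff_cancel diff_add_cancel)

lemma ip_diff_right: "ip x (y - z) = ip x y - ip x z"
  by (metis ip_add_right add_diff_cancel diff_add_cancel)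

lemma norm_ip_commute: "norm (ip x y) = norm (ip y x)"
  by (metis ip_commute norm_scnj)

lemma ip_mult_commute: "ip x y * ip y x = of_real ((norm (ip x y))\<^sup>2)"
  by (metis ip_commute mult_scnj_of_real)

lemma norm_ip_self: "norm (ip x x) = (norm x)\<^sup>2"
  by (simp only: ip_self norm_of_real) simp

lemma norm_ip_le: "norm (ip x y) \<le> norm x * norm y"
proof (cases "y = 0")
  case True
  have "ip x (0 *\<^sub>R y) = 0 *\<^sub>R ip x y"
    by (rule ip_scaleR_right)
  with True show ?thesis by simp
next
  case False
  define n where "n = (norm y)\<^sup>2"
  have n: "n > 0" using False by (simp add: n_def)
  \<comment> \<open>\<open>z\<close> is \<open>n\<close> times the component of \<open>x\<close>
    orthogonal to \<open>y\<close>; the scaling by \<open>n\<close> avoids division. Nonnegativity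
    of its squared norm is the Cauchy-Schwarz inequality up to the factor \<open>n\<close>.\<close>
  define z where "z = n *\<^sub>R x - smul (ip x y) y"
  have "of_real ((norm z)\<^sup>2) = ip z z"
    by (simp add: ip_self)
  also have "\<dots> = of_real n * of_real n * ip x x - of_real n * (ip x y * ip y x)
      - of_real n * (ip x y * ip y x) + ip x y * ip y x * ip y y"
    by (simp add: z_def ip_diff_left ip_diff_right ip_scale_left ip_scale_right ip_scaleR_left
        ip_scaleR_right scaleR_conv_of_real ip_commute[of y x, symmetric]
        ip_commute[of x y, symmetric] algebra_simps)
  also have "\<dots> = of_real (n * (n * (norm x)\<^sup>2 - (norm (ip x y))\<^sup>2))"
    by (simp only: ip_mult_commute ip_self n_def[symmetric]) (simp add: algebra_simps)
  finally have "(norm z)\<^sup>2 = n * (n * (norm x)\<^sup>2 - (norm (ip x y))\<^sup>2)"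
    by (simp only: of_real_eq_iff)
  then have "0 \<le> n * (n * (norm x)\<^sup>2 - (norm (ip x y))\<^sup>2)"
    by (metis zero_le_power2)
  with n have "(norm (ip x y))\<^sup>2 \<le> (norm x * norm y)\<^sup>2"
    by (simp add: zero_le_mult_iff n_def power_mult_distrib mult.commute)
  then show ?thesis
    by (rule power2_le_imp_le) simp
qed

lemma bounded_linear_ip_left: "bounded_linear (\<lambda>x. ip x y)"
  by (rule bounded_linear_intro[where K="norm y"])
     (simp_all add: ip_add_left ip_scaleR_left norm_ip_le)

lemma bounded_linear_ip_right: "bounded_linear (ip x)"
  by (rule bounded_linear_intro[where K="norm x"])
     (simp_all add: ip_add_right ip_scaleR_right norm_ip_le mult.commute[of "norm _" "norm x"])

section \<open>Coefficient sums and synthesis\<close>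

lemma frame_upper_bound_pos: "frame_with_bounds ip V I \<phi> A B \<Longrightarrow> 0 < B"
  by (auto simp: frame_with_bounds_def)

lemma frame_coeff_has_sum:
  assumes "frame_with_bounds ip UNIV I \<phi> A B"
  obtains q where "((\<lambda>i. (norm (ip f (\<phi> i)))\<^sup>2) has_sum q) I" "A * (norm f)\<^sup>2 \<le> q" "q \<le> B * (norm f)\<^sup>2"
  using assms by (auto simp: frame_with_bounds_def dest!: spec[of _ f] has_sum_infsum)

lemma frame_with_boundsI:
  assumes "0 < A" "A \<le> B"
    and "\<And>f. \<exists>q. ((\<lambda>i. (norm (ip f (\<phi> i)))\<^sup>2) has_sum q) I \<and> A * (norm f)\<^sup>2 \<le> q \<and> q \<le> B * (norm f)\<^sup>2"
  shows "frame_with_bounds ip UNIV I \<phi> A B"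
  unfolding frame_with_bounds_def using assms by (auto simp: has_sum_iff)

text \<open>Synthesis is adjoint to analysis and so inherits its bound: pairing the sum with itself
  reduces the estimate to the frame coefficients of the sum.\<close>

lemma norm_synthesis_finite_le:
  assumes fr: "frame_with_bounds ip UNIV I \<phi> A B" and F: "finite F" "F \<subseteq> I"
  shows "(norm (\<Sum>i\<in>F. smul (c i) (\<phi> i)))\<^sup>2 \<le> B * (\<Sum>i\<in>F. (norm (c i))\<^sup>2)"
proof -
  define g where "g = (\<Sum>i\<in>F. smul (c i) (\<phi> i))"
  note B = frame_upper_bound_pos[OF fr]
  obtain q where q: "((\<lambda>i. (norm (ip g (\<phi> i)))\<^sup>2) has_sum q) I" "q \<le> B * (norm g)\<^sup>2"
    using frame_coeff_has_sum[OF fr] by blast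
  have "(norm g)\<^sup>2 = norm (ip g g)"
    by (simp add: norm_ip_self)
  also have "ip g g = (\<Sum>i\<in>F. c i * ip (\<phi> i) g)"
    by (subst (1) g_def)
       (simp add: linear_sum[OF bounded_linear.linear[OF bounded_linear_ip_left]] ip_scale_left)
  also have "norm \<dots> \<le> (\<Sum>i\<in>F. norm (c i) * norm (ip g (\<phi> i)))"
    by (rule sum_norm_le) (simp add: norm_mult norm_ip_commute)
  \<comment> \<open>With weight \<open>B\<close> the second terms sum to at most
    \<open>(norm g)\<^sup>2\<close>, and half of that is absorbed by the left-hand side.\<close>
  also have "\<dots> \<le> (\<Sum>i\<in>F. (B * (norm (c i))\<^sup>2 + (norm (ip g (\<phi> i)))\<^sup>2 / B) / 2)"
    by (intro sum_mono mult_le_half_weighted_squares B)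
  also have "\<dots> = (B * (\<Sum>i\<in>F. (norm (c i))\<^sup>2) + (\<Sum>i\<in>F. (norm (ip g (\<phi> i)))\<^sup>2) / B) / 2"
    by (simp add: sum.distrib sum_divide_distrib[symmetric] sum_distrib_left[symmetric])
  finally have "(norm g)\<^sup>2 \<le> \<dots>" .
  moreover have "(\<Sum>i\<in>F. (norm (ip g (\<phi> i)))\<^sup>2) / B \<le> (norm g)\<^sup>2"
    using finite_sum_le_has_sum[OF q(1) F] q(2) B by (simp add: pos_divide_le_eq mult.commute)
  ultimately have "(norm g)\<^sup>2 \<le> B * (\<Sum>i\<in>F. (norm (c i))\<^sup>2)"
    by simp
  then show ?thesis by (simp only: g_def)
qed

text \<open>The finite synthesis bound turns small tails of the square sum into small tails of the
  vector sum, so the net of finite partial sums is Cauchy and converges by completeness.\<close>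

lemma synthesis_summable:
  assumes fr: "frame_with_bounds ip UNIV I \<phi> A B" and c: "(\<lambda>i. (norm (c i))\<^sup>2) summable_on I"
  shows "(\<lambda>i. smul (c i) (\<phi> i)) summable_on I"
proof -
  let ?c = "\<lambda>i. (norm (c i))\<^sup>2" and ?g = "\<lambda>i. smul (c i) (\<phi> i)"
  note B = frame_upper_bound_pos[OF fr]
  have "\<exists>P. eventually P (finite_subsets_at_top I) \<and>
      (\<forall>F F'. P F \<and> P F' \<longrightarrow> dist (sum ?g F) (sum ?g F') < e)" if e: "e > 0" for e
  proof -
    \<comment> \<open>A coefficient tail of at most \<open>d\<close> yields a vector of norm at most
      sqrt (B d) = e / 4. Two partial sums beyond \<open>G\<close> then differ by at most e /
      2.\<close>
    define d where "d = (e / 4)\<^sup>2 / B"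
    have d: "d > 0" using e B by (simp add: d_def)
    obtain G where G: "finite G" "G \<subseteq> I" "dist (sum ?c G) (infsum ?c I) \<le> d"
      using infsum_finite_approximation[OF c d] by auto
    define P where "P F \<longleftrightarrow> finite F \<and> G \<subseteq> F \<and> F \<subseteq> I" for F
    have near: "dist (sum ?g F) (sum ?g G) \<le> e / 4" if F: "P F" for F
    proof -
      have "(norm (sum ?g (F - G)))\<^sup>2 \<le> B * sum ?c (F - G)"
        by (rule norm_synthesis_finite_le[OF fr]) (use F in \<open>auto simp: P_def\<close>)
      also have "sum ?c (F - G) = sum ?c F - sum ?c G"
        using F by (simp add: P_def sum_diff)
      also have "\<dots> \<le> d"
        using finite_sum_le_infsum[OF c, of F] F G(3) by (auto simp: P_def dist_real_def)
      finally have "(norm (sum ?g (F - G)))\<^sup>2 \<le> (e / 4)\<^sup>2"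
        using B by (simp add: d_def)
      then have "norm (sum ?g (F - G)) \<le> e / 4"
        by (rule power2_le_imp_le) (use e in simp)
      then show ?thesis
        using F by (simp add: P_def sum_diff dist_norm)
    qed
    have "dist (sum ?g F) (sum ?g F') < e" if "P F" "P F'" for F F'
      using near[OF that(1)] near[OF that(2)] dist_triangle2[of "sum ?g F" "sum ?g F'" "sum ?g G"] e
      by linarith
    moreover have "eventually P (finite_subsets_at_top I)"
      using G unfolding eventually_finite_subsets_at_top P_def by blast
    ultimately show ?thesis by blast
  qed
  then have "cauchy_filter (filtermap (sum ?g) (finite_subsets_at_top I))"
    by (simp add: cauchy_filter_metric_filtermap)
  then obtain L where "(sum ?g \<longlongrightarrow> L) (finite_subsets_at_top I)"
    using complete_uniform[where S="UNIV :: 'a set"] complete_UNIV by (force simp: filterlim_def)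
  then show ?thesis
    using summable_on_def has_sum_def by blast
qed

section \<open>The frame operator and its inverse\<close>

abbreviation S :: "'i set \<Rightarrow> ('i \<Rightarrow> 'a) \<Rightarrow> 'a \<Rightarrow> 'a" where
  "S \<equiv> frame_operator smul ip"

lemma frame_operator_has_sum:
  assumes "frame_with_bounds ip UNIV I \<phi> A B"
  shows "((\<lambda>i. smul (ip f (\<phi> i)) (\<phi> i)) has_sum S I \<phi> f) I"
  unfolding frame_operator_def
  by (rule has_sum_infsum, rule synthesis_summable[OF assms])
     (use assms in \<open>simp add: frame_with_bounds_def\<close>)

lemma frame_operator_diff:
  assumes fr: "frame_with_bounds ip UNIV I \<phi> A B"
  shows "S I \<phi> (f - g) = S I \<phi> f - S I \<phi> g"
proof -
  have "((\<lambda>i. smul (ip f (\<phi> i)) (\<phi> i) + - smul (ip g (\<phi> i)) (\<phi> i)) has_sum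
      (S I \<phi> f + - S I \<phi> g)) I"
    by (intro has_sum_add) (simp_all add: has_sum_uminus frame_operator_has_sum[OF fr])
  then have "((\<lambda>i. smul (ip (f - g) (\<phi> i)) (\<phi> i)) has_sum (S I \<phi> f - S I \<phi> g)) I"
    by (simp add: ip_diff_left scale_left_diff_distrib)
  with frame_operator_has_sum[OF fr] show ?thesis
    by (rule has_sum_unique)
qed

lemma ip_frame_operator_has_sum:
  assumes "frame_with_bounds ip UNIV I \<phi> A B"
  shows "((\<lambda>i. ip f (\<phi> i) * ip (\<phi> i) g) has_sum ip (S I \<phi> f) g) I"
  using has_sum_bounded_linear[OF bounded_linear_ip_left frame_operator_has_sum[OF assms]]
  by (simp add: ip_scale_left)

lemma frame_operator_selfadjoint:
  assumes fr: "frame_with_bounds ip UNIV I \<phi> A B"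
  shows "ip (S I \<phi> f) g = ip f (S I \<phi> g)"
proof -
  have "((\<lambda>i. ip f (smul (ip g (\<phi> i)) (\<phi> i))) has_sum ip f (S I \<phi> g)) I"
    by (rule has_sum_bounded_linear[OF bounded_linear_ip_right frame_operator_has_sum[OF fr]])
  then have "((\<lambda>i. ip f (\<phi> i) * ip (\<phi> i) g) has_sum ip f (S I \<phi> g)) I"
    by (simp add: ip_scale_right ip_commute[symmetric] mult.commute)
  with ip_frame_operator_has_sum[OF fr] show ?thesis
    by (rule has_sum_unique)
qed

text \<open>The quadratic form of \<open>S\<close> is the square sum of the frame coefficients, so
  the lower frame bound says that \<open>S\<close> is at least \<open>A\<close> in the operator
  order. Both argument orders are recorded for the two cross terms in
  \<open>bij_frame_operator\<close>.\<close>

lemma ip_frame_operator_self: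
  assumes fr: "frame_with_bounds ip UNIV I \<phi> A B"
  obtains q where "ip (S I \<phi> f) f = of_real q" "ip f (S I \<phi> f) = of_real q" "A * (norm f)\<^sup>2 \<le> q"
proof -
  obtain q where q: "((\<lambda>i. (norm (ip f (\<phi> i)))\<^sup>2) has_sum q) I" "A * (norm f)\<^sup>2 \<le> q"
    using frame_coeff_has_sum[OF fr] by blast
  have "((\<lambda>i. ip f (\<phi> i) * ip (\<phi> i) f) has_sum of_real q) I"
    using has_sum_bounded_linear[OF bounded_linear_of_real q(1)] by (simp only: ip_mult_commute)
  with ip_frame_operator_has_sum[OF fr] have "ip (S I \<phi> f) f = of_real q"
    by (rule has_sum_unique)
  with q(2) frame_operator_selfadjoint[OF fr, of f f] show ?thesis by (intro that[of q]) simp_all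
qed

text \<open>\<open>S\<close> is analysis followed by synthesis, each of norm at most sqrt B. The
  estimate is made on finite partial sums and passes to the limit.\<close>

lemma norm_frame_operator_le:
  assumes fr: "frame_with_bounds ip UNIV I \<phi> A B"
  shows "norm (S I \<phi> f) \<le> B * norm f"
proof (rule norm_has_sum_le_finite_sums[OF frame_operator_has_sum[OF fr]])
  fix F assume F: "finite F" "F \<subseteq> I"
  note B = frame_upper_bound_pos[OF fr]
  obtain q where q: "((\<lambda>i. (norm (ip f (\<phi> i)))\<^sup>2) has_sum q) I" "q \<le> B * (norm f)\<^sup>2"
    using frame_coeff_has_sum[OF fr] by blast
  have "(norm (\<Sum>i\<in>F. smul (ip f (\<phi> i)) (\<phi> i)))\<^sup>2 \<le> B * (\<Sum>i\<in>F. (norm (ip f (\<phi> i)))\<^sup>2)"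
    by (rule norm_synthesis_finite_le[OF fr F])
  also have "\<dots> \<le> B * (B * (norm f)\<^sup>2)"
    using finite_sum_le_has_sum[OF q(1) F] q(2) B by (intro mult_left_mono) auto
  also have "\<dots> = (B * norm f)\<^sup>2"
    by (simp add: power2_eq_square)
  finally show "norm (\<Sum>i\<in>F. smul (ip f (\<phi> i)) (\<phi> i)) \<le> B * norm f"
    by (rule power2_le_imp_le) (use B in simp)
qed

text \<open>Cauchy-Schwarz bounds the quadratic form, which is at least
  \<open>A * (norm f)\<^sup>2\<close>, by \<open>norm (S I \<phi> f) * norm f\<close>; one factor
  \<open>norm f\<close> cancels.\<close>

lemma norm_frame_operator_ge:
  assumes fr: "frame_with_bounds ip UNIV I \<phi> A B"
  shows "A * norm f \<le> norm (S I \<phi> f)"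
proof (cases "f = 0")
  case False
  obtain q where q: "ip (S I \<phi> f) f = of_real q" "A * (norm f)\<^sup>2 \<le> q"
    using ip_frame_operator_self[OF fr] by blast
  then have "(A * norm f) * norm f \<le> norm (S I \<phi> f) * norm f"
    using norm_ip_le[of "S I \<phi> f" f] by (simp add: power2_eq_square)
  with False show ?thesis by simp
qed simp

lemma bij_frame_operator:
  assumes fr: "frame_with_bounds ip UNIV I \<phi> A B"
  shows "bij (S I \<phi>)"
proof -
  have A: "0 < A" "A \<le> B" using fr by (auto simp: frame_with_bounds_def)
  then have B: "B > 0" by simp
  \<comment> \<open>Expanding the squared norm of \<open>f - t *\<^sub>R S I \<phi> f\<close> gives
    at most the factor \<open>1 - 2 * t * A + t\<^sup>2 * B\<^sup>2\<close>. This \<open>t\<close>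
    minimises it, with value \<open>1 - (A / B)\<^sup>2\<close>, the square of the \<open>k\<close>
    below.\<close>
  define t where "t = A / B\<^sup>2"
  have t: "t > 0" using A B by (simp add: t_def)
  have "inj (S I \<phi>)"
  proof (rule injI)
    fix f g assume "S I \<phi> f = S I \<phi> g"
    then have "A * norm (f - g) \<le> 0"
      using norm_frame_operator_ge[OF fr, of "f - g"] by (simp add: frame_operator_diff[OF fr])
    with A show "f = g" by (simp add: mult_le_0_iff)
  qed
  moreover have "\<exists>g. h = S I \<phi> g" for h
  proof -
    define k where "k = sqrt (1 - (A / B)\<^sup>2)"
    have "(A / B)\<^sup>2 \<le> 1"
      using A B by (simp add: power_le_one)
    then have k: "0 \<le> k" "k < 1" "k\<^sup>2 = 1 - (A / B)\<^sup>2"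
      using A B by (simp_all add: k_def)
    have contr: "norm (f - t *\<^sub>R S I \<phi> f) \<le> k * norm f" for f
    proof -
      obtain q where q: "ip (S I \<phi> f) f = of_real q" "ip f (S I \<phi> f) = of_real q" "A * (norm f)\<^sup>2 \<le> q"
        using ip_frame_operator_self[OF fr] by blast
      have "of_real ((norm (f - t *\<^sub>R S I \<phi> f))\<^sup>2) = ip (f - t *\<^sub>R S I \<phi> f) (f - t *\<^sub>R S I \<phi> f)"
        by (rule ip_self[symmetric])
      also have "\<dots> = of_real ((norm f)\<^sup>2 - 2 * t * q + t\<^sup>2 * (norm (S I \<phi> f))\<^sup>2)"
        by (simp only: ip_diff_left ip_diff_right ip_scaleR_left ip_scaleR_right)
           (simp add: ip_self q scaleR_conv_of_real power2_eq_square algebra_simps)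
      finally have "(norm (f - t *\<^sub>R S I \<phi> f))\<^sup>2 = (norm f)\<^sup>2 - 2 * t * q + t\<^sup>2 * (norm (S I \<phi> f))\<^sup>2"
        by (simp only: of_real_eq_iff)
      also have "\<dots> \<le> (norm f)\<^sup>2 - 2 * t * (A * (norm f)\<^sup>2) + t\<^sup>2 * (B * norm f)\<^sup>2"
        using q(3) t norm_frame_operator_le[OF fr, of f]
        by (intro add_mono diff_mono mult_left_mono power_mono) auto
      also have "\<dots> = (k * norm f)\<^sup>2"
        using B unfolding power_mult_distrib k(3) t_def by (simp add: field_simps power2_eq_square)
      finally show ?thesis
        by (rule power2_le_imp_le) (use k in simp)
    qed
    have "dist (f - t *\<^sub>R (S I \<phi> f - h)) (g - t *\<^sub>R (S I \<phi> g - h)) \<le> k * dist f g" for f g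
      using contr[of "f - g"] by (simp add: dist_norm frame_operator_diff[OF fr] algebra_simps)
    then obtain g where "g - t *\<^sub>R (S I \<phi> g - h) = g"
      using banach_fix_type[OF k(1,2), of "\<lambda>g. g - t *\<^sub>R (S I \<phi> g - h)"] by blast
    then show ?thesis using t by auto
  qed
  ultimately show ?thesis by (auto simp: bij_def surj_def)
qed

text \<open>Self-adjointness moves the inverse of \<open>S\<close> from the frame vectors to
  \<open>f\<close>. The coefficients for the canonical dual are thus those of \<open>?R f\<close>
  for \<phi>, and reconstruction is the identity \<open>SR\<close>.\<close>

lemma dual_frame_canonical_dual:
  assumes fr: "frame_with_bounds ip UNIV I \<phi> A B"
  shows "dual_frame smul ip I \<phi> (canonical_dual smul ip I \<phi>)"
proof -
  have A: "0 < A" "A \<le> B" using fr by (auto simp: frame_with_bounds_def)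
  then have B: "B > 0" by simp
  let ?R = "inv (S I \<phi>)"
  have SR: "S I \<phi> (?R f) = f" for f
    using bij_frame_operator[OF fr] by (simp add: bij_is_surj surj_f_inv_f)
  have coeff: "ip f (canonical_dual smul ip I \<phi> i) = ip (?R f) (\<phi> i)" for f i
    using frame_operator_selfadjoint[OF fr, of "?R f" "?R (\<phi> i)"]
    by (simp add: canonical_dual_def SR)
  \<comment> \<open>These bounds combine those of \<phi> at \<open>?R f\<close> with
    \<open>norm f / B \<le> norm (?R f)\<close> and
    \<open>norm (?R f) \<le> norm f / A\<close>.\<close>
  have "frame_with_bounds ip UNIV I (canonical_dual smul ip I \<phi>) (A / B\<^sup>2) (B / A\<^sup>2)"
  proof (rule frame_with_boundsI)
    have "A / B\<^sup>2 \<le> B / B\<^sup>2" using A by (intro divide_right_mono) auto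
    also have "\<dots> \<le> B / A\<^sup>2" using A B by (intro divide_left_mono power_mono) auto
    finally show "A / B\<^sup>2 \<le> B / A\<^sup>2" .
    fix f :: 'a
    obtain q where q: "((\<lambda>i. (norm (ip (?R f) (\<phi> i)))\<^sup>2) has_sum q) I"
      "A * (norm (?R f))\<^sup>2 \<le> q" "q \<le> B * (norm (?R f))\<^sup>2"
      using frame_coeff_has_sum[OF fr] by blast
    have "(norm f)\<^sup>2 \<le> (B * norm (?R f))\<^sup>2"
      using norm_frame_operator_le[OF fr, of "?R f"] by (intro power_mono) (simp_all add: SR)
    then have "A * ((norm f)\<^sup>2 / B\<^sup>2) \<le> A * (norm (?R f))\<^sup>2"
      using A B by (intro mult_left_mono) (simp_all add: field_simps power_mult_distrib)
    moreover have "(A * norm (?R f))\<^sup>2 \<le> (norm f)\<^sup>2"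
      using norm_frame_operator_ge[OF fr, of "?R f"] A by (intro power_mono) (simp_all add: SR)
    then have "B * (norm (?R f))\<^sup>2 \<le> B * ((norm f)\<^sup>2 / A\<^sup>2)"
      using A B by (intro mult_left_mono) (simp_all add: field_simps power_mult_distrib)
    ultimately show "\<exists>q. ((\<lambda>i. (norm (ip f (canonical_dual smul ip I \<phi> i)))\<^sup>2) has_sum q) I \<and>
        A / B\<^sup>2 * (norm f)\<^sup>2 \<le> q \<and> q \<le> B / A\<^sup>2 * (norm f)\<^sup>2"
      using q by (intro exI[of _ q]) (simp add: coeff)
  qed (use A B in simp)
  then show ?thesis
    using frame_operator_has_sum[OF fr, of "?R _"]
    by (auto simp: dual_frame_def is_frame_def coeff SR)
qed

section \<open>Weavings with a dual frame\<close>

lemma weaving_coeff_has_sum: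
  assumes \<phi>: "frame_with_bounds ip UNIV I \<phi> A B" and \<psi>: "frame_with_bounds ip UNIV I \<psi> A' B'"
  obtains q where "((\<lambda>i. (norm (ip f (weaving J \<phi> \<psi> i)))\<^sup>2) has_sum q) I" "q \<le> (B + B') * (norm f)\<^sup>2"
proof -
  obtain p where p: "((\<lambda>i. (norm (ip f (\<phi> i)))\<^sup>2) has_sum p) I" "p \<le> B * (norm f)\<^sup>2"
    using frame_coeff_has_sum[OF \<phi>] by blast
  obtain p' where p': "((\<lambda>i. (norm (ip f (\<psi> i)))\<^sup>2) has_sum p') I" "p' \<le> B' * (norm f)\<^sup>2"
    using frame_coeff_has_sum[OF \<psi>] by blast
  have sum: "((\<lambda>i. (norm (ip f (\<phi> i)))\<^sup>2 + (norm (ip f (\<psi> i)))\<^sup>2) has_sum (p + p')) I"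
    by (rule has_sum_add[OF p(1) p'(1)])
  \<comment> \<open>At each index the weaving uses one of the two vectors, so its term is dominated
    by the sum of both. The resulting bound is uniform in \<open>J\<close>.\<close>
  have le: "(norm (ip f (weaving J \<phi> \<psi> i)))\<^sup>2 \<le> (norm (ip f (\<phi> i)))\<^sup>2 + (norm (ip f (\<psi> i)))\<^sup>2" for i
    by (simp add: weaving_def)
  have "(\<lambda>i. (norm (ip f (weaving J \<phi> \<psi> i)))\<^sup>2) summable_on I"
    by (rule summable_on_comparison_test[OF has_sum_imp_summable[OF sum] le]) simp
  then obtain q where q: "((\<lambda>i. (norm (ip f (weaving J \<phi> \<psi> i)))\<^sup>2) has_sum q) I"
    by (auto simp: summable_on_def)
  have "q \<le> p + p'"
    by (rule has_sum_mono[OF q sum le])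
  with q p(2) p'(2) that show ?thesis by (simp add: distrib_right)
qed

theorem woven_dual_frame:
  assumes fr: "is_frame ip UNIV I \<phi>" and dual: "dual_frame smul ip I \<phi> \<psi>"
  shows "woven ip I \<phi> \<psi>"
proof -
  from fr obtain A B where \<phi>: "frame_with_bounds ip UNIV I \<phi> A B"
    by (auto simp: is_frame_def)
  from dual obtain A' B' where \<psi>: "frame_with_bounds ip UNIV I \<psi> A' B'"
    by (auto simp: is_frame_def dual_frame_def)
  \<comment> \<open>The maximum with 1 ensures \<open>1 / C \<le> C\<close> even when the Hilbert space is trivial.\<close>
  define C where "C = max 1 (B + B')"
  have C: "C \<ge> 1" "B + B' \<le> C" by (auto simp: C_def)
  have "frame_with_bounds ip UNIV I (weaving J \<phi> \<psi>) (1 / C) C" for J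
  proof (rule frame_with_boundsI)
    fix f :: 'a
    have mono: "(B + B') * (norm f)\<^sup>2 \<le> C * (norm f)\<^sup>2"
      using C by (intro mult_right_mono) auto
    let ?w = "weaving J \<phi> \<psi>" and ?v = "weaving (- J) \<phi> \<psi>"
    obtain q where q: "((\<lambda>i. (norm (ip f (?w i)))\<^sup>2) has_sum q) I" "q \<le> C * (norm f)\<^sup>2"
      using weaving_coeff_has_sum[OF \<phi> \<psi>, of f J] mono by (metis order_trans)
    obtain p where p: "((\<lambda>i. (norm (ip f (?v i)))\<^sup>2) has_sum p) I" "p \<le> C * (norm f)\<^sup>2"
      using weaving_coeff_has_sum[OF \<phi> \<psi>, of f "- J"] mono by (metis order_trans)
    have "((\<lambda>i. smul (ip f (\<psi> i)) (\<phi> i)) has_sum f) I"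
      using dual by (simp add: dual_frame_def)
    from has_sum_bounded_linear[OF bounded_linear_ip_left this, of f]
    have sum: "((\<lambda>i. ip f (\<psi> i) * ip (\<phi> i) f) has_sum ip f f) I"
      by (simp add: ip_scale_left)
    have "norm (ip f f) \<le> (C * q + p / C) / 2"
    proof (rule norm_has_sum_le_finite_sums[OF sum])
      fix F assume F: "finite F" "F \<subseteq> I"
      \<comment> \<open>At every index \<open>?v\<close> takes the vector that \<open>?w\<close>
        leaves out, so the two factors agree up to order whether or not \<open>i\<close> is in
        \<open>J\<close>.\<close>
      have "norm (\<Sum>i\<in>F. ip f (\<psi> i) * ip (\<phi> i) f) \<le> (\<Sum>i\<in>F. norm (ip f (?w i)) * norm (ip f (?v i)))"
        by (rule sum_norm_le)
           (auto simp: weaving_def norm_mult norm_ip_commute[of _ f] mult.commute)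
      also have "\<dots> \<le> (\<Sum>i\<in>F. (C * (norm (ip f (?w i)))\<^sup>2 + (norm (ip f (?v i)))\<^sup>2 / C) / 2)"
        using C by (intro sum_mono mult_le_half_weighted_squares) auto
      also have "\<dots> = (C * (\<Sum>i\<in>F. (norm (ip f (?w i)))\<^sup>2) + (\<Sum>i\<in>F. (norm (ip f (?v i)))\<^sup>2) / C) / 2"
        by (simp add: sum.distrib sum_divide_distrib[symmetric] sum_distrib_left[symmetric])
      also have "\<dots> \<le> (C * q + p / C) / 2"
        using finite_sum_le_has_sum[OF q(1) F] finite_sum_le_has_sum[OF p(1) F] C
        by (intro divide_right_mono add_mono mult_left_mono) auto
      finally show "norm (\<Sum>i\<in>F. ip f (\<psi> i) * ip (\<phi> i) f) \<le> (C * q + p / C) / 2" .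
    qed
    \<comment> \<open>The weight \<open>C\<close> was chosen for this: the complementary weaving
      contributes at most half of \<open>(norm f)\<^sup>2\<close>, which is absorbed, and a lower
      bound for \<open>q\<close> remains.\<close>
    moreover have "p / C \<le> (norm f)\<^sup>2"
      using p(2) C by (simp add: pos_divide_le_eq mult.commute)
    ultimately have "(norm f)\<^sup>2 \<le> C * q"
      by (simp add: norm_ip_self)
    then have "1 / C * (norm f)\<^sup>2 \<le> q"
      using C by (simp add: pos_divide_le_eq mult.commute)
    with q show "\<exists>q. ((\<lambda>i. (norm (ip f (?w i)))\<^sup>2) has_sum q) I \<and>
        1 / C * (norm f)\<^sup>2 \<le> q \<and> q \<le> C * (norm f)\<^sup>2"
      by blast
  next
    have "1 / C \<le> 1" using C by simp
    also have "1 \<le> C" by (rule C)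
    finally show "1 / C \<le> C" .
  qed (use C in simp)
  \<comment> \<open>Both inequalities are contained in \<open>frame_with_bounds\<close>, so a single
    weaving, here for the empty set, yields them.\<close>
  moreover have "0 < 1 / C" "1 / C \<le> C"
    using calculation[of "{}"] by (auto simp: frame_with_bounds_def)
  ultimately show ?thesis
    using fr \<psi> unfolding woven_def is_frame_def by blast
qed

end

theorem theorem3p5:
  fixes smul :: "'k::real_or_complex \<Rightarrow> 'a::banach \<Rightarrow> 'a"
    and ip :: "'a \<Rightarrow> 'a \<Rightarrow> 'k"
    and I :: "'i set"
    and \<phi> :: "'i \<Rightarrow> 'a"
  assumes "hilbert_space smul ip"
    and "separable (UNIV :: 'a set)"
    and "countable I"
    and "is_frame ip UNIV I \<phi>"
  shows "(\<forall>\<psi>. dual_frame smul ip I \<phi> \<psi> \<and>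
              (\<forall>J. J \<subseteq> I \<longrightarrow> frame_sequence smul ip I (weaving J \<phi> \<psi>))
            \<longrightarrow> woven ip I \<phi> \<psi>) \<and>
         (riesz_basis smul I \<phi> \<longrightarrow> woven ip I \<phi> (canonical_dual smul ip I \<phi>))"
proof -
  interpret hilbert_space smul ip by fact
  from assms(4) obtain A B where "frame_with_bounds ip UNIV I \<phi> A B"
    by (auto simp: is_frame_def)
  then have "dual_frame smul ip I \<phi> (canonical_dual smul ip I \<phi>)"
    by (rule dual_frame_canonical_dual)
  then show ?thesis
    using woven_dual_frame[OF assms(4)] by blast
qed

end
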